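(* Let $N\ge 3$ be an integer, let $\kappa\in\mathbb{R}$, and let $q(z)=1+\kappa(z-z^{N-1})-z^N$. Then all (complex) zeros of $q$ lie on the unit circle $\{z\in\mathbb{C}:|z|=1\}$ if and only if \[ -\frac{N}{N-2}\le\kappa\le \begin{cases} 1 & \text{if } N \text{ is odd},\\ \dfrac{N}{N-2} & \text{if } N \text{ is even}. \end{cases} \] *)

theory Defs
  imports "HOL-Analysis.Analysis"
begin

definition q :: "nat \<Rightarrow> real \<Rightarrow> complex \<Rightarrow> complex" where
  "q N \<kappa> z = 1 + of_real \<kappa> * (z - z ^ (N - 1)) - z ^ N"

end

theory Submission
  imports Defs
begin

text \<open>
  The zeros of \<open>q\<close> are invariant under \<open>z \<mapsto> 1/z\<close>, so only the open unit disc matters.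
  For \<open>\<bar>\<kappa>\<bar> \<le> 1\<close>, write \<open>q z = 0\<close> as \<open>1 + \<kappa> z = z^(N-1) (\<kappa> + z)\<close> and compare moduli.
  For \<open>\<kappa> = -(1 + d)\<close> with \<open>0 < d \<le> 2/(N-2)\<close> and \<open>m = N - 1\<close>,
  \[2 q(z) / (1 - z) = (2 - d (m - 1)) (1 + z^m) + d \sum_{k=1}^{m-1} (1 - z^k) (1 - z^{m-k}),\]
  and after division by \<open>1 - z^m\<close> each term has nonnegative real part in the disc, because
  \<open>(1 - u v) / ((1 - u) (1 - v))\<close> is the mean of the Cayley transforms of \<open>u\<close> and \<open>v\<close>.
  For even \<open>N\<close>, \<open>z \<mapsto> -z\<close> exchanges \<open>\<kappa>\<close> and \<open>-\<kappa>\<close>.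
  Conversely, outside the stated range the intermediate value theorem gives a zero in \<open>(-1, 1)\<close>,
  using the sign of \<open>q\<close> at \<open>-1\<close> or of \<open>q'\<close> at \<open>1\<close>.
\<close>

text \<open>Reversing the coefficient sequence of \<open>q\<close> negates it, so \<open>q\<close>
  is self-reciprocal up to sign.\<close>

lemma q_inverse:
  assumes "z \<noteq> 0" "N \<ge> 2"
  shows "z ^ N * q N \<kappa> (inverse z) = - q N \<kappa> z"
proof -
  obtain n where N: "N = n + 2" using assms(2) by (metis add.commute le_Suc_ex)
  have "z ^ N * q N \<kappa> (inverse z) =
    z ^ N + of_real \<kappa> * (z ^ (n + 1) * (z * inverse z) - z * (z * inverse z) ^ (n + 1))
      - (z * inverse z) ^ (n + 2)"
    unfolding q_def N by (simp add: algebra_simps power_mult_distrib)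
  then show ?thesis using assms(1) by (simp add: q_def N algebra_simps)
qed

lemma q_uminus:
  assumes "even N" "N \<ge> 2"
  shows "q N \<kappa> (- z) = q N (- \<kappa>) z"
  using assms by (simp add: q_def power_minus_odd algebra_simps)

lemma q_zeros_subset_circle_iff:
  assumes "N \<ge> 2"
  shows "{z. q N \<kappa> z = 0} \<subseteq> {z. norm z = 1} \<longleftrightarrow> (\<forall>z. norm z < 1 \<longrightarrow> q N \<kappa> z \<noteq> 0)"
proof
  assume "{z. q N \<kappa> z = 0} \<subseteq> {z. norm z = 1}"
  then show "\<forall>z. norm z < 1 \<longrightarrow> q N \<kappa> z \<noteq> 0" by auto
next
  assume disc: "\<forall>z. norm z < 1 \<longrightarrow> q N \<kappa> z \<noteq> 0"
  show "{z. q N \<kappa> z = 0} \<subseteq> {z. norm z = 1}"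
  proof safe
    fix z assume z: "q N \<kappa> z = 0"
    then have ge: "norm z \<ge> 1" using disc by force
    then have "z \<noteq> 0" by auto
    then have "q N \<kappa> (inverse z) = 0" using q_inverse[OF _ assms, of z \<kappa>] z by simp
    then have "\<not> norm (inverse z) < 1" using disc by blast
    then have "\<not> norm z > 1" by (simp add: norm_inverse inverse_less_1_iff)
    then show "norm z = 1" using ge by linarith
  qed
qed

lemma norm_power_less_one:
  fixes z :: complex
  assumes "norm z < 1" "k > 0"
  shows "norm (z ^ k) < 1"
  using assms by (simp add: norm_power power_less_one_iff)

lemma q_nonzero_abs_le_one:
  assumes "\<bar>\<kappa>\<bar> \<le> 1" "norm z < 1" "N \<ge> 2"
  shows "q N \<kappa> z \<noteq> 0"
proof
  assume "q N \<kappa> z = 0"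
  moreover have "z ^ N = z ^ (N - 1) * z"
    using assms(3) by (metis Suc_diff_1 power_Suc2 less_le_trans zero_less_numeral)
  ultimately have "1 + of_real \<kappa> * z = z ^ (N - 1) * (of_real \<kappa> + z)"
    by (simp add: q_def algebra_simps)
  then have eq: "norm (1 + of_real \<kappa> * z) = norm (z ^ (N - 1)) * norm (of_real \<kappa> + z)"
    by (metis norm_mult)
  \<comment> \<open>The identity behind the disc automorphism
    \<open>(\<kappa> + z) / (1 + \<kappa> * z)\<close>, valid also when \<open>\<kappa>\<close> is 1
    or -1.\<close>
  have "(norm (1 + of_real \<kappa> * z))\<^sup>2 - (norm (of_real \<kappa> + z))\<^sup>2 = (1 - \<kappa>\<^sup>2) * (1 - (norm z)\<^sup>2)"
    unfolding cmod_power2 by (simp add: power2_eq_square algebra_simps)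
  moreover have "\<kappa>\<^sup>2 \<le> 1" using assms(1) by (simp add: abs_square_le_1)
  moreover have "(norm z)\<^sup>2 \<le> 1" using assms(2) by (simp add: power_le_one)
  ultimately have "(norm (of_real \<kappa> + z))\<^sup>2 \<le> (norm (1 + of_real \<kappa> * z))\<^sup>2"
    by (smt (verit) mult_nonneg_nonneg)
  then have le: "norm (of_real \<kappa> + z) \<le> norm (1 + of_real \<kappa> * z)"
    by (rule power2_le_imp_le) simp
  have "norm (of_real \<kappa> * z) < 1"
    using assms mult_right_mono[of "\<bar>\<kappa>\<bar>" 1 "norm z"] by (simp add: norm_mult)
  \<comment> \<open>Strict positivity makes multiplication by \<open>norm (z ^ (N - 1)) < 1\<close>
    a strict decrease, which contradicts \<open>eq\<close>.\<close>
  then have pos: "norm (1 + of_real \<kappa> * z) > 0"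
    using norm_diff_ineq[of 1 "of_real \<kappa> * z"] by (simp del: zero_less_norm_iff)
  have "norm (z ^ (N - 1)) < 1" using assms by (intro norm_power_less_one) auto
  then have "norm (z ^ (N - 1)) * norm (1 + of_real \<kappa> * z) < norm (1 + of_real \<kappa> * z)"
    using pos by simp
  then show False
    using eq mult_left_mono[OF le, of "norm (z ^ (N - 1))"] by simp
qed

text \<open>Multiplying by the conjugate of the denominator leaves real part
  \<open>1 - (norm u)\<^sup>2\<close> in the numerator.\<close>

lemma Re_Cayley_pos:
  assumes "norm u < 1"
  shows "Re ((1 + u) / (1 - u)) > 0"
proof -
  have "(norm u)\<^sup>2 < 1" using assms by (simp add: power_less_one_iff)
  then have "Re ((1 + u) * cnj (1 - u)) > 0"
    unfolding cmod_power2 by (simp add: power2_eq_square algebra_simps)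
  then show ?thesis by (simp add: Re_complex_div_gt_0)
qed

lemma Re_inverse_pos:
  assumes "Re w > 0"
  shows "Re (inverse w) > 0"
  using assms Re_complex_div_gt_0[of 1 w] by (simp add: inverse_eq_divide)

lemma Re_one_minus_products_pos:
  assumes u: "norm u < 1" and v: "norm v < 1"
  shows "Re ((1 - u) * (1 - v) / (1 - u * v)) > 0"
proof -
  have ne: "1 - u \<noteq> 0" "1 - v \<noteq> 0" using u v by auto
  have "(1 - u * v) / ((1 - u) * (1 - v)) = ((1 + u) / (1 - u) + (1 + v) / (1 - v)) / 2"
    using ne by (simp add: divide_simps) (simp add: algebra_simps)
  then have "Re ((1 - u * v) / ((1 - u) * (1 - v))) =
      (Re ((1 + u) / (1 - u)) + Re ((1 + v) / (1 - v))) / 2"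
    by (simp only: Re_divide_numeral plus_complex.sel)
  then have "Re ((1 - u * v) / ((1 - u) * (1 - v))) > 0"
    using Re_Cayley_pos[OF u] Re_Cayley_pos[OF v] by (metis add_pos_pos half_gt_zero)
  \<comment> \<open>Taking reciprocals preserves the open right half-plane.\<close>
  from Re_inverse_pos[OF this] show ?thesis by simp
qed

text \<open>Each product expands to \<open>1 + z ^ (n + 1)\<close> minus two powers of
  \<open>z\<close> swapped by \<open>k\<close> to \<open>n + 1 - k\<close>. Summing gives twice a
  geometric sum, and the terms with \<open>d * n\<close> cancel.\<close>

lemma q_symmetric_decomposition:
  "2 * q (n + 2) (- (1 + d)) z =
    (1 - z) * (of_real (2 - d * n) * (1 + z ^ (n + 1)) +
      of_real d * (\<Sum>k=1..n. (1 - z ^ k) * (1 - z ^ (n + 1 - k))))"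
proof -
  define S where "S = (\<Sum>k=1..n. z ^ k)"
  have rev: "(\<Sum>k=1..n. z ^ (n + 1 - k)) = S"
    unfolding S_def using sum.atLeastAtMost_rev[of "\<lambda>k. z ^ k" 1 n] by (simp only: add.commute)
  have "(\<Sum>k=1..n. (1 - z ^ k) * (1 - z ^ (n + 1 - k))) =
      (\<Sum>k=1..n. (1 + z ^ (n + 1)) - z ^ k - z ^ (n + 1 - k))"
    by (intro sum.cong refl) (simp add: algebra_simps flip: power_add power_Suc)
  also have "\<dots> = of_nat n * (1 + z ^ (n + 1)) - 2 * S"
    by (simp only: sum_subtractf rev S_def[symmetric]) simp
  finally have sum: "(\<Sum>k=1..n. (1 - z ^ k) * (1 - z ^ (n + 1 - k))) =
      of_nat n * (1 + z ^ (n + 1)) - 2 * S" .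
  have geo: "(1 - z) * S = z - z ^ (n + 1)"
    unfolding S_def by (cases "n = 0") (simp_all add: sum_gp_multiplied)
  have "(1 - z) * (of_real (2 - d * n) * (1 + z ^ (n + 1)) +
      of_real d * (of_nat n * (1 + z ^ (n + 1)) - 2 * S)) =
    2 * (1 - z) * (1 + z ^ (n + 1)) - 2 * of_real d * ((1 - z) * S)"
    by (simp add: algebra_simps)
  also have "\<dots> = 2 * q (n + 2) (- (1 + d)) z"
    unfolding geo q_def by (simp add: algebra_simps)
  finally show ?thesis unfolding sum by simp
qed

lemma q_nonzero_below_minus_one:
  assumes z: "norm z < 1" and n: "n > 0" and d: "d > 0" "d * real n \<le> 2"
  shows "q (n + 2) (- (1 + d)) z \<noteq> 0"
proof
  assume 0: "q (n + 2) (- (1 + d)) z = 0"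
  define S where "S = (\<Sum>k=1..n. (1 - z ^ k) * (1 - z ^ (n + 1 - k)))"
  define W where "W = of_real (2 - d * n) * (1 + z ^ (n + 1)) + of_real d * S"
  have "z \<noteq> 1" using z by auto
  then have "W = 0"
    using 0 q_symmetric_decomposition[of n d z] by (simp add: W_def S_def)
  have "Re ((1 - z ^ k) * (1 - z ^ (n + 1 - k)) / (1 - z ^ (n + 1))) > 0" if "k \<in> {1..n}" for k
    using Re_one_minus_products_pos[of "z ^ k" "z ^ (n + 1 - k)"] that z
    by (simp add: norm_power_less_one flip: power_add power_Suc)
  \<comment> \<open>This sum supplies the strict inequality: the coefficient
    \<open>2 - d * n\<close> of the other term vanishes at the extreme value
    \<open>d = 2 / n\<close>.\<close>
  then have "(\<Sum>k=1..n. Re ((1 - z ^ k) * (1 - z ^ (n + 1 - k)) / (1 - z ^ (n + 1)))) > 0"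
    using n by (intro sum_pos) auto
  then have "Re (S / (1 - z ^ (n + 1))) > 0"
    by (simp only: S_def sum_divide_distrib Re_sum)
  moreover have "Re ((1 + z ^ (n + 1)) / (1 - z ^ (n + 1))) > 0"
    by (rule Re_Cayley_pos) (use z in \<open>intro norm_power_less_one; simp\<close>)
  moreover have "W / (1 - z ^ (n + 1)) =
      of_real (2 - d * n) * ((1 + z ^ (n + 1)) / (1 - z ^ (n + 1))) +
      of_real d * (S / (1 - z ^ (n + 1)))"
    unfolding W_def add_divide_distrib[of "_ * _"] times_divide_eq_right ..
  then have "Re (W / (1 - z ^ (n + 1))) =
      (2 - d * n) * Re ((1 + z ^ (n + 1)) / (1 - z ^ (n + 1))) +
      d * Re (S / (1 - z ^ (n + 1)))"
    by (simp only: plus_complex.sel Re_complex_of_real Im_complex_of_real times_complex.sel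
        mult_zero_left diff_zero)
  ultimately have "Re (W / (1 - z ^ (n + 1))) > 0"
    using d by (simp only:) (intro add_nonneg_pos mult_nonneg_nonneg mult_pos_pos; simp)
  then show False using \<open>W = 0\<close> by simp
qed

lemma q_nonzero_disc:
  assumes "norm z < 1" "n > 0" "- (1 + 2 / real n) \<le> \<kappa>" "\<kappa> \<le> 1"
  shows "q (n + 2) \<kappa> z \<noteq> 0"
proof (cases "\<kappa> < - 1")
  case True
  then have "(- 1 - \<kappa>) * real n \<le> 2" using assms by (simp add: field_simps)
  then show ?thesis
    using q_nonzero_below_minus_one[of z n "- 1 - \<kappa>"] True assms by simp
next
  case False
  then show ?thesis using q_nonzero_abs_le_one[of \<kappa> z "n + 2"] assms by auto
qed

lemma q_of_real:
  "q N \<kappa> (of_real x) = of_real (1 + \<kappa> * (x - x ^ (N - 1)) - x ^ N)"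
  by (simp add: q_def)

lemma q_zero_above_one:
  assumes "odd N" "N \<ge> 3" "\<kappa> > 1"
  shows "\<exists>z. norm z < 1 \<and> q N \<kappa> z = 0"
proof -
  define f where "f x = 1 + \<kappa> * (x - x ^ (N - 1)) - x ^ N" for x :: real
  \<comment> \<open>For odd \<open>N\<close> the value at -1 is
    \<open>2 * (1 - \<kappa>)\<close>.\<close>
  have "f (- 1) < 0" "f 0 = 1"
    using assms by (simp_all add: f_def power_0_left)
  moreover have "continuous_on {- 1..0} f" unfolding f_def by (intro continuous_intros)
  ultimately obtain x where x: "- 1 \<le> x" "x \<le> 0" "f x = 0"
    using IVT'[of f "- 1" 0 0] by auto
  then have "x \<noteq> - 1" using \<open>f (- 1) < 0\<close> by auto
  then have "norm (complex_of_real x) < 1" using x by simp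
  moreover have "q N \<kappa> (of_real x) = 0" using x(3) by (simp only: q_of_real f_def of_real_0)
  ultimately show ?thesis by blast
qed

text \<open>On the real line \<open>f 1 = 0\<close>, and the bound on \<open>\<kappa>\<close> says
  exactly that the slope \<open>- \<kappa> * n - (n + 2)\<close> there is positive. So
  \<open>f\<close> is negative just left of 1, while \<open>f 0 = 1\<close>.\<close>

lemma q_zero_below:
  assumes "n > 0" "\<kappa> < - (1 + 2 / real n)"
  shows "\<exists>z. norm z < 1 \<and> q (n + 2) \<kappa> z = 0"
proof -
  define f where "f x = 1 + \<kappa> * (x - x ^ (n + 1)) - x ^ (n + 2)" for x :: real
  have "(f has_real_derivative \<kappa> * (1 - real (n + 1)) - real (n + 2)) (at 1)"
    unfolding f_def by (auto intro!: derivative_eq_intros)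
  moreover have "\<kappa> * (1 - real (n + 1)) - real (n + 2) > 0"
    using assms by (simp add: field_simps)
  ultimately obtain e where e: "e > 0" "\<And>h. h > 0 \<Longrightarrow> h < e \<Longrightarrow> f (1 - h) < f 1"
    using DERIV_pos_inc_left by metis
  \<comment> \<open>The minimum keeps \<open>y\<close> within \<open>e\<close> of 1 and also
    strictly positive.\<close>
  define y where "y = 1 - min (e / 2) (1 / 2)"
  have "f y < f 1" using e(1) e(2)[of "min (e / 2) (1 / 2)"] by (simp add: y_def min_less_iff_disj)
  then have "f y < 0" by (simp add: f_def)
  moreover have "f 0 = 1" by (simp add: f_def)
  moreover have y: "0 < y" "y < 1" using e(1) by (auto simp: y_def)
  moreover have "continuous_on {0..y} f" unfolding f_def by (intro continuous_intros)
  ultimately obtain x where x: "0 \<le> x" "x \<le> y" "f x = 0"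
    using IVT2'[of f y 0 0] by auto
  then have "norm (complex_of_real x) < 1" using y by simp
  moreover have "q (n + 2) \<kappa> (of_real x) = 0"
    using x(3) by (simp add: q_of_real f_def del: of_real_diff of_real_add of_real_mult)
  ultimately show ?thesis by blast
qed

theorem theorem5:
  fixes N :: nat and \<kappa> :: real
  assumes "N \<ge> 3"
  shows "{z :: complex. q N \<kappa> z = 0} \<subseteq> {z :: complex. norm z = 1} \<longleftrightarrow>
           - (real N / (real N - 2)) \<le> \<kappa> \<and>
           \<kappa> \<le> (if odd N then 1 else real N / (real N - 2))"
proof -
  obtain n where N: "N = n + 2" and n: "n > 0"
    using assms by (intro that[of "N - 2"]) auto
  have frac: "real N / (real N - 2) = 1 + 2 / real n"
    using n by (simp add: N field_simps)
  have "(\<forall>z. norm z < 1 \<longrightarrow> q N \<kappa> z \<noteq> 0) \<longleftrightarrow>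
      - (1 + 2 / real n) \<le> \<kappa> \<and> \<kappa> \<le> (if odd N then 1 else 1 + 2 / real n)"
    (is "?disc \<longleftrightarrow> ?lower \<and> \<kappa> \<le> ?upper")
  proof (intro iffI conjI)
    assume ?disc
    then show ?lower using q_zero_below[OF n, of \<kappa>] N by (meson not_le)
    show "\<kappa> \<le> ?upper"
    proof (cases "odd N")
      case True
      then show ?thesis using \<open>?disc\<close> q_zero_above_one[OF _ assms, of \<kappa>] by fastforce
    next
      case False
      \<comment> \<open>For even \<open>N\<close> the reflected disc condition turns the lower
        bound, applied to \<open>- \<kappa>\<close>, into the upper bound.\<close>
      have "q N (- \<kappa>) z \<noteq> 0" if "norm z < 1" for z
        using \<open>?disc\<close>[rule_format, of "- z"] that q_uminus[of N \<kappa> z] False assms by simp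
      then show ?thesis using q_zero_below[OF n, of "- \<kappa>"] N False by force
    qed
  next
    assume bounds: "?lower \<and> \<kappa> \<le> ?upper"
    show ?disc
    proof (intro allI impI)
      fix z :: complex assume z: "norm z < 1"
      show "q N \<kappa> z \<noteq> 0"
      proof (cases "\<kappa> \<le> 1")
        case True
        then show ?thesis using q_nonzero_disc[OF z n] bounds N by blast
      next
        case False
        then have "even N" using bounds by (auto split: if_splits)
        moreover have "q N (- \<kappa>) (- z) \<noteq> 0"
          using q_nonzero_disc[of "- z" n "- \<kappa>"] z n False bounds \<open>even N\<close> N by simp
        ultimately show ?thesis using q_uminus[of N "- \<kappa>" z] assms by simp
      qed
    qed
  qed
  then show ?thesis using assms by (simp only: frac q_zeros_subset_circle_iff)
qed

end
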